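(* Let $A$ be a complex commutative semi-simple regular Banach algebra, let $\sigma : A \rightarrow A$ be an automorphism, and let $\widetilde{\sigma} : \Delta(A) \rightarrow \Delta(A)$, $\widetilde{\sigma}(\mu) = \mu \circ \sigma^{-1}$, be the homeomorphism of $\Delta(A)$ (with the Gelfand topology) induced by $\sigma$. Then the following three properties are equivalent: (1) The set $\mathrm{Per}^{\infty}(\Delta(A))$ of non-periodic points of $(\Delta(A), \widetilde{\sigma})$ is dense in $\Delta(A)$; (2) Every non-zero ideal $I \subseteq A \rtimes_{\sigma} \mathbb{Z}$ is such that $I \cap A \neq \{0\}$; (3) $A$ is a maximal abelian subalgebra of $A \rtimes_{\sigma} \mathbb{Z}$.
   Context: $\Delta(A)$ denotes the character space of $A$ (the non-zero complex algebra homomorphisms $A \to \mathbb{C}$) with the Gelfand topology, i.e. the weakest topology making all Gelfand transforms $\widehat{a}$, $\widehat{a}(\mu) = \mu(a)$, $a \in A$, continuous. A commutative Banach algebra $A$ (not assumed unital) is semi-simple if the Gelfand transform $a \mapsto \widehat{a}$ is injective; it is regular if for every closed $F \subseteq \Delta(A)$ and every $\phi_0 \in \Delta(A) \setminus F$ there is $a \in A$ with $\widehat{a}(\phi) = 0$ for all $\phi \in F$ and $\widehat{a}(\phi_0) \neq 0$. "Automorphism" means algebra automorphism. The crossed product $A \rtimes_{\sigma} \mathbb{Z}$ is the purely algebraic one: the set of functions $f : \mathbb{Z} \to A$ with $f(n) = 0$ for all but finitely many $n$, with pointwise addition and scalar multiplication and multiplication given by twisted convolution $(f*g)(n) = \sum_{k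 \in \mathbb{Z}} f(k) \cdot \sigma^k(g(n-k))$. Elements are written as finite sums $\sum_{n} f_n \delta^n$ with $f_n = f(n)$, so that $(a\delta^n)*(b\delta^m) = a\,\sigma^n(b)\,\delta^{n+m}$. The algebra $A$ is identified with the subalgebra $\{a \delta^0 : a \in A\}$ of $A \rtimes_{\sigma} \mathbb{Z}$. Ideals are two-sided. For non-zero $n \in \mathbb{Z}$, $\mathrm{Per}^n(\Delta(A)) = \{\mu \in \Delta(A) : \mu = \widetilde{\sigma}^n(\mu)\}$, and $\mathrm{Per}^{\infty}(\Delta(A)) = \bigcap_{n \in \mathbb{Z} \setminus \{0\}} (\Delta(A) \setminus \mathrm{Per}^n(\Delta(A)))$. *)

theory Defs
  imports "HOL-Analysis.Analysis"
begin

text \<open>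
  Commutative complex Banach algebras, not necessarily unital. The complex scalar multiplication
  extends the real one provided by the class hierarchy, so \<open>1 *\<^sub>C x = x\<close> is the case \<open>r = 1\<close> of
  \<open>of_real_scaleC\<close>.
\<close>

class comm_complex_banach_algebra = real_normed_algebra + banach + comm_ring +
  fixes scaleC :: "complex \<Rightarrow> 'a \<Rightarrow> 'a"  (infixr "*\<^sub>C" 75)
  assumes scaleC_add_right: "c *\<^sub>C (x + y) = c *\<^sub>C x + c *\<^sub>C y"
    and scaleC_add_left: "(c + d) *\<^sub>C x = c *\<^sub>C x + d *\<^sub>C x"
    and scaleC_scaleC: "c *\<^sub>C (d *\<^sub>C x) = (c * d) *\<^sub>C x"
    and of_real_scaleC: "of_real r *\<^sub>C x = r *\<^sub>R x"
    and scaleC_mult_left: "(c *\<^sub>C x) * y = c *\<^sub>C (x * y)"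
    and norm_scaleC: "norm (c *\<^sub>C x) = cmod c * norm x"

definition character_space :: "('a::comm_complex_banach_algebra \<Rightarrow> complex) set" where
  "character_space = {\<mu>.
     (\<forall>x y. \<mu> (x + y) = \<mu> x + \<mu> y) \<and>
     (\<forall>c x. \<mu> (c *\<^sub>C x) = c * \<mu> x) \<and>
     (\<forall>x y. \<mu> (x * y) = \<mu> x * \<mu> y) \<and>
     \<mu> \<noteq> (\<lambda>_. 0)}"

definition gelfand_transform ::
    "'a::comm_complex_banach_algebra \<Rightarrow> ('a \<Rightarrow> complex) \<Rightarrow> complex" where
  "gelfand_transform a = (\<lambda>\<mu>\<in>character_space. \<mu> a)"

definition gelfand_topology :: "('a::comm_complex_banach_algebra \<Rightarrow> complex) topology" where
  "gelfand_topology = topology_generated_by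
     {gelfand_transform a -` U \<inter> character_space | a U. open U}"

definition semisimple :: "'a::comm_complex_banach_algebra itself \<Rightarrow> bool" where
  "semisimple _ \<longleftrightarrow> inj (gelfand_transform :: 'a \<Rightarrow> ('a \<Rightarrow> complex) \<Rightarrow> complex)"

definition regular :: "'a::comm_complex_banach_algebra itself \<Rightarrow> bool" where
  "regular _ \<longleftrightarrow>
     (\<forall>F (\<phi>\<^sub>0 :: 'a \<Rightarrow> complex). closedin gelfand_topology F \<and> \<phi>\<^sub>0 \<in> character_space - F \<longrightarrow>
        (\<exists>a. (\<forall>\<phi>\<in>F. gelfand_transform a \<phi> = 0) \<and> gelfand_transform a \<phi>\<^sub>0 \<noteq> 0))"

definition algebra_automorphism :: "('a::comm_complex_banach_algebra \<Rightarrow> 'a) \<Rightarrow> bool" where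
  "algebra_automorphism \<sigma> \<longleftrightarrow> bij \<sigma> \<and>
     (\<forall>x y. \<sigma> (x + y) = \<sigma> x + \<sigma> y) \<and>
     (\<forall>c x. \<sigma> (c *\<^sub>C x) = c *\<^sub>C \<sigma> x) \<and>
     (\<forall>x y. \<sigma> (x * y) = \<sigma> x * \<sigma> y)"

text \<open>Integer iterates of a bijection.\<close>

definition int_iter :: "('b \<Rightarrow> 'b) \<Rightarrow> int \<Rightarrow> 'b \<Rightarrow> 'b" where
  "int_iter f n = (if n \<ge> 0 then f ^^ nat n else inv f ^^ nat (- n))"

text \<open>
  For bijective \<open>\<sigma>\<close> the map \<open>dual_map \<sigma>\<close> is a bijection of the whole function type, with inverse
  \<open>\<mu> \<mapsto> \<mu> \<circ> \<sigma>\<close>; so its integer iterates restrict to those of the induced homeomorphism of the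
  character space.
\<close>

definition dual_map :: "('a \<Rightarrow> 'a) \<Rightarrow> ('a \<Rightarrow> complex) \<Rightarrow> 'a \<Rightarrow> complex" where
  "dual_map \<sigma> \<mu> = \<mu> \<circ> inv \<sigma>"

definition periodic_points ::
    "('a::comm_complex_banach_algebra \<Rightarrow> 'a) \<Rightarrow> int \<Rightarrow> ('a \<Rightarrow> complex) set" where
  "periodic_points \<sigma> n = {\<mu> \<in> character_space. \<mu> = int_iter (dual_map \<sigma>) n \<mu>}"

definition nonperiodic_points ::
    "('a::comm_complex_banach_algebra \<Rightarrow> 'a) \<Rightarrow> ('a \<Rightarrow> complex) set" where
  "nonperiodic_points \<sigma> = (\<Inter>n\<in>UNIV - {0}. character_space - periodic_points \<sigma> n)"

text \<open>
  The algebraic crossed product: addition and scalar multiplication are pointwise, and only the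
  multiplication depends on \<open>\<sigma>\<close>. An element \<open>f\<close> stands for the finite sum of the \<open>f n \<delta>\<^sup>n\<close>.
\<close>

definition crossed_product :: "(int \<Rightarrow> 'a::comm_complex_banach_algebra) set" where
  "crossed_product = {f. finite {n. f n \<noteq> 0}}"

definition twisted_conv ::
    "('a::comm_complex_banach_algebra \<Rightarrow> 'a) \<Rightarrow> (int \<Rightarrow> 'a) \<Rightarrow> (int \<Rightarrow> 'a) \<Rightarrow> int \<Rightarrow> 'a" where
  "twisted_conv \<sigma> f g = (\<lambda>n. \<Sum>k | f k \<noteq> 0. f k * int_iter \<sigma> k (g (n - k)))"

definition cp_subspace :: "(int \<Rightarrow> 'a::comm_complex_banach_algebra) set \<Rightarrow> bool" where
  "cp_subspace S \<longleftrightarrow> S \<subseteq> crossed_product \<and>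
     (\<lambda>_. 0) \<in> S \<and>
     (\<forall>f\<in>S. \<forall>g\<in>S. (\<lambda>n. f n + g n) \<in> S) \<and>
     (\<forall>c. \<forall>f\<in>S. (\<lambda>n. c *\<^sub>C f n) \<in> S)"

definition cp_ideal ::
    "('a::comm_complex_banach_algebra \<Rightarrow> 'a) \<Rightarrow> (int \<Rightarrow> 'a) set \<Rightarrow> bool" where
  "cp_ideal \<sigma> I \<longleftrightarrow> cp_subspace I \<and>
     (\<forall>f\<in>I. \<forall>g\<in>crossed_product. twisted_conv \<sigma> f g \<in> I \<and> twisted_conv \<sigma> g f \<in> I)"

definition cp_abelian_subalgebra ::
    "('a::comm_complex_banach_algebra \<Rightarrow> 'a) \<Rightarrow> (int \<Rightarrow> 'a) set \<Rightarrow> bool" where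
  "cp_abelian_subalgebra \<sigma> B \<longleftrightarrow> cp_subspace B \<and>
     (\<forall>f\<in>B. \<forall>g\<in>B. twisted_conv \<sigma> f g \<in> B) \<and>
     (\<forall>f\<in>B. \<forall>g\<in>B. twisted_conv \<sigma> f g = twisted_conv \<sigma> g f)"

definition cp_maximal_abelian_subalgebra ::
    "('a::comm_complex_banach_algebra \<Rightarrow> 'a) \<Rightarrow> (int \<Rightarrow> 'a) set \<Rightarrow> bool" where
  "cp_maximal_abelian_subalgebra \<sigma> B \<longleftrightarrow> cp_abelian_subalgebra \<sigma> B \<and>
     (\<forall>C. cp_abelian_subalgebra \<sigma> C \<and> B \<subseteq> C \<longrightarrow> C = B)"

text \<open>The copy \<open>{a \<delta>\<^sup>0 | a \<in> A}\<close> of the coefficient algebra in the crossed product.\<close>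

definition coeff_algebra :: "(int \<Rightarrow> 'a::comm_complex_banach_algebra) set" where
  "coeff_algebra = range (\<lambda>a n. if n = 0 then a else 0)"

end

theory Submission
  imports Defs
begin

text \<open>
  All three properties turn out to say the same thing about single coefficients. For an integer
  \<open>n\<close> let \<open>fixing n\<close> be the set of those \<open>b\<close> with \<open>b \<sigma>\<^sup>n(a) = b a\<close> for all \<open>a\<close>: multiplication by
  \<open>b\<close> cannot tell \<open>\<sigma>\<^sup>n\<close> from the identity. The common reformulation is that \<open>fixing n\<close> is trivial for
  every \<open>n \<noteq> 0\<close>.

  \<^item> Maximality (\<open>maximal_abelian_iff_fixing\<close>). Comparing coefficients in \<open>f a = a f\<close> shows that the
    commutant of the coefficient algebra \<open>A\<close> consists of the \<open>f\<close> with \<open>f\<^sub>n \<in> fixing n\<close> for all \<open>n\<close>.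
    This commutant is itself abelian, so \<open>A\<close> is maximal abelian exactly when it is its own
    commutant.

  \<^item> Ideals (\<open>ideals_meet_coeff_iff_fixing\<close>). If every \<open>fixing n\<close> with \<open>n \<noteq> 0\<close> is trivial, a non-zero
    element of the ideal with the least number of non-zero coefficients can be shifted so that its
    coefficient at \<open>0\<close> survives. Its commutators with \<open>A\<close> are shorter, hence vanish, so it lies in
    the commutant, which is \<open>A\<close>. Conversely the crossed product acts on \<open>A\<close> by letting
    \<open>f\<^sub>n \<delta>\<^sup>n\<close> send \<open>a\<close> to \<open>f\<^sub>n \<sigma>\<^sup>n(a)\<close>. The kernel of this action is an ideal that meets \<open>A\<close>
    trivially, and it contains \<open>b \<delta>\<^sup>0 - b \<delta>\<^sup>n\<close> for every \<open>b \<in> fixing n\<close>. Both directions rest on the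
    fact that no non-zero element annihilates \<open>A\<close>.

  \<^item> Density (\<open>fixing_trivial_iff_interior_empty\<close>, \<open>dense_iff_interiors_empty\<close>). By semi-simplicity
    \<open>b \<in> fixing n\<close> means that the characters not vanishing at \<open>b\<close> are fixed by the \<open>-n\<close>-th iterate
    of the induced homeomorphism. Those characters form an open set, and by regularity every
    non-empty open set contains a non-empty one of this kind. So \<open>fixing n\<close> is trivial exactly when
    the closed set of points of period \<open>-n\<close> has empty interior. The character space, being a compact
    space with one point removed, is locally compact Hausdorff, and Baire's theorem shows that all
    these interiors are empty exactly when their union has empty interior, that is, when the
    non-periodic points are dense.
\<close>

section \<open>Integer iterates of an automorphism\<close>

lemma int_iter_0 [simp]: "int_iter f 0 = id"
  by (simp add: int_iter_def)

lemma int_iter_add_1: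
  assumes "bij f"
  shows "int_iter f (n + 1) x = f (int_iter f n x)"
proof (cases "n \<ge> 0")
  case True
  then show ?thesis
    by (simp add: int_iter_def nat_add_distrib)
next
  case False
  then have "nat (- n) = Suc (nat (- (n + 1)))"
    by simp
  with False assms show ?thesis
    by (cases "n = -1") (auto simp: int_iter_def bij_is_surj surj_f_inv_f)
qed

lemma int_iter_add:
  assumes "bij f"
  shows "int_iter f (m + n) x = int_iter f m (int_iter f n x)"
proof (induction m rule: int_induct[where k = 0])
  case base
  show ?case by simp
next
  case (step1 i)
  then show ?case
    using int_iter_add_1[OF assms, of "i + n" x] int_iter_add_1[OF assms, of i] by (simp add: ac_simps)
next
  case (step2 i)
  have "f (int_iter f (i - 1 + n) x) = int_iter f (i + n) x"
    using int_iter_add_1[OF assms, of "i - 1 + n" x] by (simp add: algebra_simps)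
  also have "\<dots> = f (int_iter f (i - 1) (int_iter f n x))"
    using step2 int_iter_add_1[OF assms, of "i - 1" "int_iter f n x"] by simp
  finally show ?case
    using assms by (simp add: bij_is_inj inj_eq)
qed

lemma int_iter_minus_cancel:
  assumes "bij f"
  shows "int_iter f (- n) (int_iter f n x) = x" "int_iter f n (int_iter f (- n) x) = x"
  using int_iter_add[OF assms, of "- n" n x] int_iter_add[OF assms, of n "- n" x] by simp_all

lemma bij_dual_map:
  assumes "bij \<sigma>"
  shows "bij (dual_map \<sigma>)"
proof (rule o_bij)
  show "(\<lambda>\<mu>. \<mu> \<circ> \<sigma>) \<circ> dual_map \<sigma> = id" "dual_map \<sigma> \<circ> (\<lambda>\<mu>. \<mu> \<circ> \<sigma>) = id"
    using assms by (auto simp: dual_map_def fun_eq_iff bij_is_inj bij_is_surj surj_f_inv_f)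
qed

lemma int_iter_dual_map:
  assumes "bij \<sigma>"
  shows "int_iter (dual_map \<sigma>) n \<mu> = \<mu> \<circ> int_iter \<sigma> (- n)"
proof (induction n rule: int_induct[where k = 0])
  case base
  show ?case by simp
next
  case (step1 i)
  have "int_iter (dual_map \<sigma>) (i + 1) \<mu> = dual_map \<sigma> (\<mu> \<circ> int_iter \<sigma> (- i))"
    using step1 int_iter_add_1[OF bij_dual_map[OF assms], of i] by (simp add: comp_def)
  also have "\<dots> = \<mu> \<circ> int_iter \<sigma> (- (i + 1))"
    using int_iter_add[OF assms, of "- i" "- 1"] by (auto simp: dual_map_def fun_eq_iff int_iter_def[of _ "-1"])
  finally show ?case .
next
  case (step2 i)
  have "dual_map \<sigma> (int_iter (dual_map \<sigma>) (i - 1) \<mu>) = \<mu> \<circ> int_iter \<sigma> (- i)"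
    using step2 int_iter_add_1[OF bij_dual_map[OF assms], of "i - 1"] by (simp add: comp_def)
  then have "int_iter (dual_map \<sigma>) (i - 1) \<mu> = \<mu> \<circ> int_iter \<sigma> (- i) \<circ> \<sigma>"
    using assms by (auto simp: dual_map_def fun_eq_iff bij_is_inj) (metis assms bij_inv_eq_iff)
  also have "\<dots> = \<mu> \<circ> int_iter \<sigma> (- (i - 1))"
    using int_iter_add[OF assms, of "- i" 1] by (auto simp: fun_eq_iff int_iter_def[of _ 1])
  finally show ?case .
qed

section \<open>The Gelfand topology\<close>

text \<open>
  The type-class topology on a function type is that of pointwise convergence, so the weakest
  topology making all evaluations continuous is inherited from the ambient function space. Through
  this equality the results on product spaces become available.
\<close>

lemma gelfand_topology_eq:
  "gelfand_topology = top_of_set (character_space :: ('a::comm_complex_banach_algebra \<Rightarrow> complex) set)"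
  (is "?G = ?T")
proof (rule topology_eq[THEN iffD2], intro allI iffI)
  fix S :: "('a \<Rightarrow> complex) set"
  have vimage: "gelfand_transform a -` U \<inter> character_space = {\<mu> \<in> character_space. \<mu> a \<in> U}"
    for a :: 'a and U
    by (auto simp: gelfand_transform_def)
  have top: "topspace ?G = (character_space :: ('a \<Rightarrow> complex) set)"
    unfolding gelfand_topology_def topology_generated_by_topspace by (auto intro!: exI[of _ UNIV])
  {
    assume "openin ?G S"
    then have "generate_topology_on
        {gelfand_transform a -` U \<inter> character_space | a U. open U} S"
      by (simp add: gelfand_topology_def openin_topology_generated_by_iff)
    then show "openin ?T S"
    proof induction
      case (Basis s)
      then obtain a :: 'a and U where "open U" "s = {\<mu> \<in> character_space. \<mu> a \<in> U}"
        using vimage by blast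
      moreover have "open ((\<lambda>\<mu> :: 'a \<Rightarrow> complex. \<mu> a) -` U)"
        by (intro open_vimage \<open>open U\<close>) simp
      ultimately show ?case
        by (auto simp: openin_open)
    qed auto
  }
  assume "openin ?T S"
  then obtain W where W: "open W" "S = character_space \<inter> W"
    by (auto simp: openin_open)
  have "continuous_map ?G euclidean (\<lambda>\<mu> :: 'a \<Rightarrow> complex. \<mu> a)" for a
    unfolding continuous_map_def top
  proof (intro conjI allI impI)
    fix U :: "complex set"
    assume "openin euclidean U"
    then show "openin ?G {\<mu> \<in> character_space. \<mu> a \<in> U}"
      unfolding gelfand_topology_def vimage[symmetric]
      by (intro topology_generated_by_Basis) auto
  qed simp
  then have "continuous_map ?G (product_topology (\<lambda>_. euclidean) UNIV) (\<lambda>\<mu> :: 'a \<Rightarrow> complex. \<mu>)"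
    by (simp add: continuous_map_componentwise_UNIV)
  then have "continuous_map ?G euclidean (\<lambda>\<mu> :: 'a \<Rightarrow> complex. \<mu>)"
    by (simp add: euclidean_product_topology)
  then have "openin ?G {\<mu> \<in> topspace ?G. \<mu> \<in> W}"
    using W(1) by (auto dest: openin_continuous_map_preimage)
  moreover have "{\<mu> \<in> topspace ?G. \<mu> \<in> W} = S"
    using W(2) top by auto
  ultimately show "openin ?G S"
    by simp
qed

lemma topspace_gelfand_topology: "topspace gelfand_topology = character_space"
  by (simp add: gelfand_topology_eq)

lemma continuous_on_eval: "continuous_on S (\<lambda>\<mu> :: 'a \<Rightarrow> complex. \<mu> a)"
  by (rule continuous_on_subset[OF continuous_on_product_coordinates]) simp

lemma character_simps:
  fixes \<mu> :: "'a::comm_complex_banach_algebra \<Rightarrow> complex"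
  assumes "\<mu> \<in> character_space"
  shows "\<mu> (x + y) = \<mu> x + \<mu> y" "\<mu> (x * y) = \<mu> x * \<mu> y" "\<mu> 0 = 0"
proof -
  have hom: "\<mu> (u + v) = \<mu> u + \<mu> v" "\<mu> (u * v) = \<mu> u * \<mu> v" for u v
    using assms by (simp_all add: character_space_def)
  show "\<mu> (x + y) = \<mu> x + \<mu> y" "\<mu> (x * y) = \<mu> x * \<mu> y" "\<mu> 0 = 0"
    using hom(1)[of 0 0] by (simp_all add: hom)
qed

text \<open>
  A character exceeding the norm would take the value \<open>1\<close> at some \<open>c\<close> of norm less than \<open>1\<close>. Then
  \<open>s \<mapsto> c + c s\<close> is a contraction, and applying the character to its fixed point gives
  \<open>1 + \<mu> s = \<mu> s\<close>. The fixed point stands for the sum of the positive powers of \<open>c\<close>, which makes the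
  argument work without a unit.
\<close>

lemma character_norm_le:
  fixes \<mu> :: "'a::comm_complex_banach_algebra \<Rightarrow> complex"
  assumes "\<mu> \<in> character_space"
  shows "norm (\<mu> a) \<le> norm a"
proof (rule ccontr)
  assume "\<not> norm (\<mu> a) \<le> norm a"
  then have less: "norm a < norm (\<mu> a)" by simp
  then have nz: "\<mu> a \<noteq> 0" by auto
  define c where "c = inverse (\<mu> a) *\<^sub>C a"
  have \<mu>c: "\<mu> c = 1"
    using assms nz by (simp add: c_def character_space_def)
  have c: "norm c < 1"
    using less nz unfolding c_def norm_scaleC norm_inverse by (simp add: field_simps)
  have "\<forall>x y. dist (c + c * x) (c + c * y) \<le> norm c * dist x y"
    by (metis add_diff_cancel_left dist_norm norm_mult_ineq right_diff_distrib)
  then obtain s where "c + c * s = s"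
    using banach_fix_type[of "norm c" "\<lambda>s. c + c * s"] c by auto
  then have "\<mu> c + \<mu> c * \<mu> s = \<mu> s"
    using character_simps[OF assms] by metis
  with \<mu>c show False by simp
qed

lemma scaleC_0_right [simp]: "c *\<^sub>C (0 :: 'a::comm_complex_banach_algebra) = 0"
  using scaleC_add_right[of c "0 :: 'a" 0] by simp

lemma uminus_eq_scaleC: "(-1) *\<^sub>C (x :: 'a::comm_complex_banach_algebra) = - x"
  using of_real_scaleC[of "-1" x] by simp

text \<open>
  Banach--Alaoglu for characters: once the zero functional is adjoined, the characters are cut out
  of a product of compact discs by closed conditions.
\<close>

lemma characters_with_zero_compact:
  "compact (insert (\<lambda>_. 0) (character_space :: ('a::comm_complex_banach_algebra \<Rightarrow> complex) set))"
proof -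
  let ?K = "insert (\<lambda>_. 0) (character_space :: ('a \<Rightarrow> complex) set)"
  have eq: "?K = (\<Inter>x. \<Inter>y. {\<mu>. \<mu> (x + y) = \<mu> x + \<mu> y}) \<inter> (\<Inter>c. \<Inter>x. {\<mu>. \<mu> (c *\<^sub>C x) = c * \<mu> x})
      \<inter> (\<Inter>x. \<Inter>y. {\<mu>. \<mu> (x * y) = \<mu> x * \<mu> y})"
    by (auto simp: character_space_def)
  have "closed ?K"
    unfolding eq by (intro closed_Int closed_INT ballI closed_Collect_eq continuous_intros continuous_on_eval)
  moreover have "compact (PiE UNIV (\<lambda>a :: 'a. cball (0 :: complex) (norm a)))"
    using compactin_PiE[of "\<lambda>_. euclidean" UNIV "\<lambda>a :: 'a. cball (0 :: complex) (norm a)"]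
    by (simp add: euclidean_product_topology)
  moreover have "?K \<subseteq> PiE UNIV (\<lambda>a :: 'a. cball (0 :: complex) (norm a))"
    using character_norm_le by auto
  ultimately show ?thesis
    by (metis compact_Int_closed inf.absorb_iff2)
qed

lemma Hausdorff_gelfand: "Hausdorff_space (gelfand_topology :: ('a::comm_complex_banach_algebra \<Rightarrow> complex) topology)"
  unfolding gelfand_topology_eq euclidean_product_topology[symmetric]
  by (intro Hausdorff_space_subtopology) (simp add: Hausdorff_space_product_topology)

text \<open>Removing the zero functional from the compact set above leaves an open subset.\<close>

lemma locally_compact_gelfand:
  "locally_compact_space (gelfand_topology :: ('a::comm_complex_banach_algebra \<Rightarrow> complex) topology)"
proof -
  let ?K = "insert (\<lambda>_. 0) (character_space :: ('a \<Rightarrow> complex) set)"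
  let ?X = "product_topology (\<lambda>_ :: 'a. euclidean :: complex topology) UNIV"
  have X: "?X = euclidean"
    by (rule euclidean_product_topology)
  have H: "Hausdorff_space (subtopology ?X ?K)"
    by (intro Hausdorff_space_subtopology) (simp add: Hausdorff_space_product_topology)
  have "compact_space (subtopology ?X ?K)"
    unfolding X using characters_with_zero_compact by (intro compact_space_subtopology) simp
  moreover have "openin (subtopology ?X ?K) (?K - {\<lambda>_. 0})"
    using closedin_Hausdorff_singleton[OF H, of "\<lambda>_. 0"] by (simp add: closedin_def)
  ultimately have "locally_compact_space (subtopology (subtopology ?X ?K) (?K - {\<lambda>_. 0}))"
    using H by (intro locally_compact_space_open_subset compact_imp_locally_compact_space) auto
  moreover have "?K \<inter> (?K - {\<lambda>_. 0}) = character_space"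
    by (auto simp: character_space_def)
  ultimately show ?thesis
    by (simp add: subtopology_subtopology gelfand_topology_eq X)
qed

lemma semisimple_eqI:
  fixes a b :: "'a::comm_complex_banach_algebra"
  assumes "semisimple TYPE('a)" and "\<And>\<mu>. \<mu> \<in> character_space \<Longrightarrow> \<mu> a = \<mu> b"
  shows "a = b"
proof -
  have "gelfand_transform a = gelfand_transform b"
    using assms(2) by (auto simp: gelfand_transform_def)
  with assms(1) show ?thesis
    by (auto simp: semisimple_def dest: injD)
qed

lemma semisimple_annihilator:
  fixes b :: "'a::comm_complex_banach_algebra"
  assumes "semisimple TYPE('a)" and "\<And>a. b * a = 0"
  shows "b = 0"
proof (rule semisimple_eqI[OF assms(1)])
  fix \<mu> :: "'a \<Rightarrow> complex"
  assume \<mu>: "\<mu> \<in> character_space"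
  have "\<mu> b * \<mu> b = \<mu> (b * b)"
    using \<mu> by (simp add: character_simps)
  with assms(2) \<mu> show "\<mu> b = \<mu> 0"
    by (simp add: character_simps)
qed

section \<open>Elements of the crossed product\<close>

definition monomial :: "'a \<Rightarrow> int \<Rightarrow> int \<Rightarrow> 'a::comm_complex_banach_algebra" where
  "monomial a n = (\<lambda>k. if k = n then a else 0)"

lemma monomial_mem [simp]: "monomial a n \<in> crossed_product"
  by (auto simp: crossed_product_def monomial_def)

lemma coeff_algebra_iff: "f \<in> coeff_algebra \<longleftrightarrow> (\<forall>n. n \<noteq> 0 \<longrightarrow> f n = 0)"
  by (auto simp: coeff_algebra_def image_iff fun_eq_iff intro!: exI[of _ "f 0"])

lemma coeff_algebra_eq: "coeff_algebra = range (\<lambda>a. monomial a 0)"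
  by (simp add: coeff_algebra_def monomial_def)

locale crossed_product_algebra =
  fixes \<sigma> :: "'a::comm_complex_banach_algebra \<Rightarrow> 'a"
  assumes automorphism: "algebra_automorphism \<sigma>"
begin

abbreviation pow :: "int \<Rightarrow> 'a \<Rightarrow> 'a" where
  "pow \<equiv> int_iter \<sigma>"

abbreviation conv :: "(int \<Rightarrow> 'a) \<Rightarrow> (int \<Rightarrow> 'a) \<Rightarrow> int \<Rightarrow> 'a"  (infixl "\<star>" 70) where
  "f \<star> g \<equiv> twisted_conv \<sigma> f g"

lemma bij: "bij \<sigma>"
  using automorphism by (simp add: algebra_automorphism_def)

lemmas pow_pow = int_iter_add[OF bij, symmetric]
lemmas pow_inverse = int_iter_minus_cancel[OF bij]

lemma inv_homomorphism:
  "inv \<sigma> (x + y) = inv \<sigma> x + inv \<sigma> y" "inv \<sigma> (c *\<^sub>C x) = c *\<^sub>C inv \<sigma> x"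
  "inv \<sigma> (x * y) = inv \<sigma> x * inv \<sigma> y"
proof -
  have inv: "\<sigma> (inv \<sigma> z) = z" "inv \<sigma> (\<sigma> z) = z" for z
    using bij by (simp_all add: bij_is_inj bij_is_surj surj_f_inv_f)
  have hom: "\<sigma> (u + v) = \<sigma> u + \<sigma> v" "\<sigma> (c *\<^sub>C u) = c *\<^sub>C \<sigma> u" "\<sigma> (u * v) = \<sigma> u * \<sigma> v" for u v
    using automorphism by (simp_all add: algebra_automorphism_def)
  show "inv \<sigma> (x + y) = inv \<sigma> x + inv \<sigma> y"
    using hom(1)[of "inv \<sigma> x" "inv \<sigma> y"] inv by metis
  show "inv \<sigma> (c *\<^sub>C x) = c *\<^sub>C inv \<sigma> x"
    using hom(2)[of "inv \<sigma> x"] inv by metis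
  show "inv \<sigma> (x * y) = inv \<sigma> x * inv \<sigma> y"
    using hom(3)[of "inv \<sigma> x" "inv \<sigma> y"] inv by metis
qed

lemma pow_add: "pow n (x + y) = pow n x + pow n y"
  and pow_scaleC: "pow n (c *\<^sub>C x) = c *\<^sub>C pow n x"
  and pow_mult: "pow n (x * y) = pow n x * pow n y"
proof -
  have "(\<sigma> ^^ k) (x + y) = (\<sigma> ^^ k) x + (\<sigma> ^^ k) y"
    "(\<sigma> ^^ k) (c *\<^sub>C x) = c *\<^sub>C (\<sigma> ^^ k) x" "(\<sigma> ^^ k) (x * y) = (\<sigma> ^^ k) x * (\<sigma> ^^ k) y" for k
    using automorphism by (induction k) (auto simp: algebra_automorphism_def)
  moreover have "(inv \<sigma> ^^ k) (x + y) = (inv \<sigma> ^^ k) x + (inv \<sigma> ^^ k) y"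
    "(inv \<sigma> ^^ k) (c *\<^sub>C x) = c *\<^sub>C (inv \<sigma> ^^ k) x"
    "(inv \<sigma> ^^ k) (x * y) = (inv \<sigma> ^^ k) x * (inv \<sigma> ^^ k) y" for k
    by (induction k) (auto simp: inv_homomorphism)
  ultimately show "pow n (x + y) = pow n x + pow n y"
    "pow n (c *\<^sub>C x) = c *\<^sub>C pow n x" "pow n (x * y) = pow n x * pow n y"
    by (simp_all add: int_iter_def)
qed

lemma pow_0 [simp]: "pow n 0 = 0"
  using pow_add[of n 0 0] by simp

lemma pow_sum: "pow n (sum g S) = (\<Sum>x\<in>S. pow n (g x))"
  by (induction S rule: infinite_finite_induct) (auto simp: pow_add)

lemma conv_eq_sum:
  assumes "finite S" and "{k. f k \<noteq> 0} \<subseteq> S"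
  shows "(f \<star> g) n = (\<Sum>k\<in>S. f k * pow k (g (n - k)))"
  unfolding twisted_conv_def using assms by (intro sum.mono_neutral_left) auto

lemma conv_support:
  "{n. (f \<star> g) n \<noteq> 0} \<subseteq> (\<lambda>(k, m). k + m) ` ({k. f k \<noteq> 0} \<times> {m. g m \<noteq> 0})"
proof
  fix n
  assume "n \<in> {n. (f \<star> g) n \<noteq> 0}"
  then obtain k where "f k \<noteq> 0" "f k * pow k (g (n - k)) \<noteq> 0"
    unfolding twisted_conv_def mem_Collect_eq by (rule sum.not_neutral_contains_not_neutral) simp
  then have "(k, n - k) \<in> {k. f k \<noteq> 0} \<times> {m. g m \<noteq> 0}"
    by auto
  then show "n \<in> (\<lambda>(k, m). k + m) ` ({k. f k \<noteq> 0} \<times> {m. g m \<noteq> 0})"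
    by (rule rev_image_eqI) simp
qed

lemma conv_mem:
  assumes "f \<in> crossed_product" and "g \<in> crossed_product"
  shows "f \<star> g \<in> crossed_product"
  using finite_subset[OF conv_support] assms by (simp add: crossed_product_def)

lemma monomial_conv: "(monomial a n \<star> g) m = a * pow n (g (m - n))"
proof -
  have "{k. monomial a n k \<noteq> 0} \<subseteq> {n}"
    by (auto simp: monomial_def)
  then show ?thesis
    using conv_eq_sum[of "{n}" "monomial a n" g m] by (simp add: monomial_def)
qed

lemma conv_monomial:
  assumes "f \<in> crossed_product"
  shows "(f \<star> monomial a n) m = f (m - n) * pow (m - n) a"
proof -
  have "(f \<star> monomial a n) m = (\<Sum>k\<in>insert (m - n) {k. f k \<noteq> 0}. f k * pow k (monomial a n (m - k)))"
    using assms by (intro conv_eq_sum) (auto simp: crossed_product_def)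
  also have "\<dots> = (\<Sum>k\<in>{m - n}. f k * pow k (monomial a n (m - k)))"
    using assms by (intro sum.mono_neutral_right) (auto simp: crossed_product_def monomial_def)
  finally show ?thesis
    by (simp add: monomial_def)
qed

section \<open>The commutant of the coefficient algebra\<close>

definition fixing :: "int \<Rightarrow> 'a set" where
  "fixing n = {b. \<forall>a. b * pow n a = b * a}"

definition coeff_commutant :: "(int \<Rightarrow> 'a) set" where
  "coeff_commutant = {f \<in> crossed_product. \<forall>n. f n \<in> fixing n}"

lemma zero_fixing [simp]: "0 \<in> fixing n"
  by (simp add: fixing_def)

lemma commutes_with_coeff_iff:
  assumes "f \<in> crossed_product"
  shows "(\<forall>a. f \<star> monomial a 0 = monomial a 0 \<star> f) \<longleftrightarrow> f \<in> coeff_commutant"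
  using assms
  by (auto simp: coeff_commutant_def fixing_def fun_eq_iff monomial_conv conv_monomial mult.commute)

text \<open>
  On the commutant the twist disappears: if \<open>f\<^sub>k \<in> fixing k\<close>, then \<open>f\<^sub>k \<sigma>\<^sup>k(x) = f\<^sub>k x\<close>, so the product is
  the ordinary convolution over a commutative ring.
\<close>

lemma coeff_commutant_abelian: "cp_abelian_subalgebra \<sigma> coeff_commutant"
  unfolding cp_abelian_subalgebra_def cp_subspace_def
proof (intro conjI ballI allI)
  show "coeff_commutant \<subseteq> crossed_product"
    by (auto simp: coeff_commutant_def)
  show "(\<lambda>_. 0) \<in> coeff_commutant"
    by (auto simp: coeff_commutant_def crossed_product_def)
  fix f g :: "int \<Rightarrow> 'a" and c
  assume f: "f \<in> coeff_commutant"
  then have finf: "finite {k. f k \<noteq> 0}" and fixf: "\<And>k a. f k * pow k a = f k * a"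
    by (auto simp: coeff_commutant_def crossed_product_def fixing_def)
  have "finite {k. c *\<^sub>C f k \<noteq> 0}"
    by (rule finite_subset[OF _ finf]) auto
  then show "(\<lambda>n. c *\<^sub>C f n) \<in> coeff_commutant"
    using fixf by (auto simp: coeff_commutant_def crossed_product_def fixing_def scaleC_mult_left)
  assume g: "g \<in> coeff_commutant"
  then have fing: "finite {k. g k \<noteq> 0}" and fixg: "\<And>k a. g k * pow k a = g k * a"
    by (auto simp: coeff_commutant_def crossed_product_def fixing_def)
  have "finite {k. f k + g k \<noteq> 0}"
    by (rule finite_subset[OF _ finite_UnI[OF finf fing]]) auto
  then show "(\<lambda>n. f n + g n) \<in> coeff_commutant"
    using fixf fixg by (auto simp: coeff_commutant_def crossed_product_def fixing_def distrib_right)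
  show "f \<star> g = g \<star> f"
  proof
    fix n
    define S where "S = {k. f k \<noteq> 0} \<union> (\<lambda>k. n - k) ` {k. g k \<noteq> 0}"
    have S: "finite S"
      using finf fing by (simp add: S_def)
    have "(f \<star> g) n = (\<Sum>k\<in>S. f k * g (n - k))"
      using conv_eq_sum[OF S, of f g n] by (auto simp: S_def fixf)
    also have "\<dots> = (\<Sum>k\<in>(\<lambda>k. n - k) ` S. g k * f (n - k))"
      by (subst sum.reindex) (auto simp: inj_on_def mult.commute)
    also have "\<dots> = (g \<star> f) n"
    proof -
      have "{k. g k \<noteq> 0} \<subseteq> (\<lambda>k. n - k) ` S"
        by (auto simp: S_def image_Un image_image)
      with conv_eq_sum[OF finite_imageI[OF S], of g "\<lambda>k. n - k" f n] show ?thesis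
        by (simp add: fixg)
    qed
    finally show "(f \<star> g) n = (g \<star> f) n" .
  qed
  have "(f \<star> g) m * pow m a = (f \<star> g) m * a" for m a
  proof -
    have term_fixed: "f k * pow k (g (m - k)) * pow m a = f k * pow k (g (m - k)) * a" for k
    proof -
      have "f k * pow k (g (m - k)) * pow m a = f k * pow k (g (m - k) * pow (m - k) a)"
        by (simp add: pow_mult pow_pow mult.assoc)
      also have "\<dots> = f k * pow k (g (m - k)) * a"
        by (simp add: fixf fixg mult.assoc)
      finally show ?thesis .
    qed
    show ?thesis
      unfolding twisted_conv_def sum_distrib_right term_fixed ..
  qed
  moreover have "f \<star> g \<in> crossed_product"
    using f g by (auto intro: conv_mem simp: coeff_commutant_def)
  ultimately show "f \<star> g \<in> coeff_commutant"
    by (simp add: coeff_commutant_def fixing_def)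
qed

lemma coeff_subset_commutant: "coeff_algebra \<subseteq> coeff_commutant"
proof
  fix f :: "int \<Rightarrow> 'a"
  assume "f \<in> coeff_algebra"
  then obtain a where "f = monomial a 0"
    by (auto simp: coeff_algebra_eq)
  moreover have "monomial a 0 n \<in> fixing n" for n
    by (simp add: monomial_def fixing_def)
  ultimately show "f \<in> coeff_commutant"
    by (simp add: coeff_commutant_def)
qed

lemma coeff_algebra_abelian: "cp_abelian_subalgebra \<sigma> coeff_algebra"
proof -
  have "f \<star> g \<in> coeff_algebra" if "f \<in> coeff_algebra" "g \<in> coeff_algebra" for f g
    using that by (auto simp: coeff_algebra_eq[symmetric] coeff_algebra_iff twisted_conv_def intro!: sum.neutral)
      (metis diff_zero mult_zero_right pow_0)
  moreover have "cp_subspace (coeff_algebra :: (int \<Rightarrow> 'a) set)"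
    using coeff_subset_commutant
    by (auto simp: cp_subspace_def coeff_algebra_iff coeff_commutant_def)
  ultimately show ?thesis
    using coeff_commutant_abelian coeff_subset_commutant
    unfolding cp_abelian_subalgebra_def by blast
qed

lemma maximal_abelian_iff_fixing:
  "cp_maximal_abelian_subalgebra \<sigma> coeff_algebra \<longleftrightarrow> (\<forall>n. n \<noteq> 0 \<longrightarrow> fixing n = {0})"
proof
  assume "cp_maximal_abelian_subalgebra \<sigma> coeff_algebra"
  then have eq: "coeff_commutant = coeff_algebra"
    using coeff_commutant_abelian coeff_subset_commutant
    unfolding cp_maximal_abelian_subalgebra_def by blast
  have "b = 0" if "n \<noteq> 0" "b \<in> fixing n" for n b
  proof -
    have "monomial b n \<in> coeff_commutant"
      using that by (simp add: coeff_commutant_def) (simp add: monomial_def)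
    then have "monomial b n n = 0"
      using that unfolding eq coeff_algebra_iff by simp
    then show ?thesis
      by (simp add: monomial_def)
  qed
  then show "\<forall>n. n \<noteq> 0 \<longrightarrow> fixing n = {0}"
    using zero_fixing by blast
next
  assume fixing: "\<forall>n. n \<noteq> 0 \<longrightarrow> fixing n = {0}"
  show "cp_maximal_abelian_subalgebra \<sigma> coeff_algebra"
    unfolding cp_maximal_abelian_subalgebra_def
  proof (intro conjI allI impI coeff_algebra_abelian)
    fix C
    assume C: "cp_abelian_subalgebra \<sigma> C \<and> coeff_algebra \<subseteq> C"
    have "f \<in> coeff_algebra" if "f \<in> C" for f
    proof -
      have "f \<in> crossed_product"
        using C that by (auto simp: cp_abelian_subalgebra_def cp_subspace_def)
      moreover have "f \<star> monomial a 0 = monomial a 0 \<star> f" for a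
      proof -
        have "monomial a 0 \<in> C"
          using C by (auto simp: coeff_algebra_eq)
        with C that show ?thesis
          by (simp add: cp_abelian_subalgebra_def)
      qed
      ultimately have "f \<in> coeff_commutant"
        using commutes_with_coeff_iff by blast
      then show ?thesis
        using fixing by (auto simp: coeff_commutant_def coeff_algebra_iff)
    qed
    with C show "C = coeff_algebra"
      by blast
  qed
qed

section \<open>Ideals and the coefficient algebra\<close>

text \<open>
  The covariant representation of the crossed product on its coefficient algebra, in which \<open>A\<close> acts
  by multiplication and \<open>\<delta>\<close> acts as \<open>\<sigma>\<close>.
\<close>

definition act :: "(int \<Rightarrow> 'a) \<Rightarrow> 'a \<Rightarrow> 'a" where
  "act f a = (\<Sum>k | f k \<noteq> 0. f k * pow k a)"

lemma act_eq_sum: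
  assumes "finite S" and "{k. f k \<noteq> 0} \<subseteq> S"
  shows "act f a = (\<Sum>k\<in>S. f k * pow k a)"
  unfolding act_def using assms by (intro sum.mono_neutral_left) auto

lemma act_0_right [simp]: "act f 0 = 0"
  by (simp add: act_def)

text \<open>
  The twist in the product is exactly what makes \<open>act\<close> multiplicative; this is why its kernel is a
  two-sided ideal.
\<close>

lemma act_conv:
  assumes "f \<in> crossed_product" and "g \<in> crossed_product"
  shows "act (f \<star> g) a = act f (act g a)"
proof -
  define K where "K = {k. f k \<noteq> 0}"
  define M where "M = {m. g m \<noteq> 0}"
  define N where "N = (\<lambda>(k, m). k + m) ` (K \<times> M)"
  have fin: "finite K" "finite M" "finite N"
    using assms by (simp_all add: K_def M_def N_def crossed_product_def)
  have inner: "(\<Sum>n\<in>N. f k * pow k (g (n - k)) * pow n a)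
      = (\<Sum>m\<in>M. f k * pow k (g m) * pow (k + m) a)" if "k \<in> K" for k
  proof -
    have "(\<Sum>n\<in>N. f k * pow k (g (n - k)) * pow n a)
        = (\<Sum>n\<in>(+) k ` M. f k * pow k (g (n - k)) * pow n a)"
    proof (rule sum.mono_neutral_right[OF fin(3)])
      show "(+) k ` M \<subseteq> N"
        using that by (auto simp: N_def)
      show "\<forall>n\<in>N - (+) k ` M. f k * pow k (g (n - k)) * pow n a = 0"
      proof
        fix n
        assume "n \<in> N - (+) k ` M"
        then have "n - k \<notin> M"
          by (metis DiffD2 add_diff_cancel_left' diff_add_cancel image_eqI add.commute)
        then show "f k * pow k (g (n - k)) * pow n a = 0"
          by (simp add: M_def)
      qed
    qed
    then show ?thesis
      by (simp add: sum.reindex)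
  qed
  have "act (f \<star> g) a = (\<Sum>n\<in>N. (f \<star> g) n * pow n a)"
    using fin conv_support[of f g] by (intro act_eq_sum) (auto simp: N_def K_def M_def)
  also have "\<dots> = (\<Sum>n\<in>N. \<Sum>k\<in>K. f k * pow k (g (n - k)) * pow n a)"
    by (simp add: twisted_conv_def K_def sum_distrib_right)
  also have "\<dots> = (\<Sum>k\<in>K. \<Sum>n\<in>N. f k * pow k (g (n - k)) * pow n a)"
    by (rule sum.swap)
  also have "\<dots> = (\<Sum>k\<in>K. \<Sum>m\<in>M. f k * pow k (g m) * pow (k + m) a)"
    using inner by simp
  also have "\<dots> = act f (act g a)"
    by (simp add: act_def K_def M_def pow_sum pow_mult pow_pow sum_distrib_left mult.assoc)
  finally show ?thesis .
qed

definition act_kernel :: "(int \<Rightarrow> 'a) set" where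
  "act_kernel = {f \<in> crossed_product. \<forall>a. act f a = 0}"

lemma act_kernel_ideal: "cp_ideal \<sigma> act_kernel"
  unfolding cp_ideal_def cp_subspace_def
proof (intro conjI ballI allI)
  show "act_kernel \<subseteq> crossed_product"
    by (auto simp: act_kernel_def)
  show "(\<lambda>_. 0) \<in> act_kernel"
    by (auto simp: act_kernel_def crossed_product_def act_def)
  fix f g :: "int \<Rightarrow> 'a" and c
  assume f: "f \<in> act_kernel"
  then have finf: "finite {k. f k \<noteq> 0}" and actf: "\<And>a. (\<Sum>k | f k \<noteq> 0. f k * pow k a) = 0"
    by (auto simp: act_kernel_def crossed_product_def act_def)
  have supp: "{k. c *\<^sub>C f k \<noteq> 0} \<subseteq> {k. f k \<noteq> 0}"
    by auto
  have scaleC_sum: "c *\<^sub>C sum h S = (\<Sum>k\<in>S. c *\<^sub>C h k)" for h :: "int \<Rightarrow> 'a" and S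
    by (induction S rule: infinite_finite_induct) (auto simp: scaleC_add_right)
  have "act (\<lambda>n. c *\<^sub>C f n) a = c *\<^sub>C (\<Sum>k | f k \<noteq> 0. f k * pow k a)" for a
    using act_eq_sum[OF finf supp] by (simp add: scaleC_mult_left scaleC_sum)
  then show "(\<lambda>n. c *\<^sub>C f n) \<in> act_kernel"
    using actf finite_subset[OF supp finf] by (simp add: act_kernel_def crossed_product_def)
  {
    assume g: "g \<in> crossed_product"
    show "f \<star> g \<in> act_kernel" "g \<star> f \<in> act_kernel"
      using f g by (auto simp: act_kernel_def conv_mem act_conv)
  }
  assume g: "g \<in> act_kernel"
  let ?S = "{k. f k \<noteq> 0} \<union> {k. g k \<noteq> 0}"
  have fing: "finite {k. g k \<noteq> 0}"
    using g by (auto simp: act_kernel_def crossed_product_def)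
  have S: "finite ?S" "{k. f k + g k \<noteq> 0} \<subseteq> ?S"
    using finf fing by auto
  have "act (\<lambda>n. f n + g n) a = act f a + act g a" for a
    using act_eq_sum[OF S(1), of f] act_eq_sum[OF S(1), of g] act_eq_sum[OF S]
    by (simp add: distrib_right sum.distrib)
  then show "(\<lambda>n. f n + g n) \<in> act_kernel"
    using f g finite_subset[OF S(2,1)] by (simp add: act_kernel_def crossed_product_def)
qed

text \<open>An element of \<open>A\<close> acts by multiplication, so it acts as zero only if it annihilates \<open>A\<close>.\<close>

lemma act_kernel_inter_coeff:
  assumes faithful: "\<forall>b :: 'a. (\<forall>a. b * a = 0) \<longrightarrow> b = 0"
  shows "act_kernel \<inter> coeff_algebra = {\<lambda>_. 0}"
proof -
  have "b = 0" if "monomial b 0 \<in> act_kernel" for b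
  proof (rule faithful[rule_format])
    fix a
    show "b * a = 0"
    proof -
      have "{k. monomial b 0 k \<noteq> 0} \<subseteq> {0}"
        by (auto simp: monomial_def)
      then have "act (monomial b 0) a = b * a"
        using act_eq_sum[of "{0}" "monomial b 0" a] by (simp add: monomial_def)
      with that show ?thesis
        by (simp add: act_kernel_def)
    qed
  qed
  moreover have "monomial 0 0 = (\<lambda>_. 0 :: 'a)"
    by (simp add: monomial_def)
  moreover have "(\<lambda>_. 0) \<in> act_kernel"
    using act_kernel_ideal by (simp add: cp_ideal_def cp_subspace_def)
  moreover have "(\<lambda>_. 0 :: 'a) \<in> coeff_algebra"
    by (simp add: coeff_algebra_iff)
  ultimately show ?thesis
    unfolding coeff_algebra_eq by blast
qed

text \<open>
  For \<open>b \<in> fixing n\<close> the elements \<open>b \<delta>\<^sup>0\<close> and \<open>b \<delta>\<^sup>n\<close> act on \<open>A\<close> by the same operator, so their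
  difference witnesses that the action fails to be faithful.
\<close>

lemma fixing_in_act_kernel:
  assumes "b \<in> fixing n" and "n \<noteq> 0"
  shows "(\<lambda>k. if k = 0 then b else if k = n then - b else 0) \<in> act_kernel" (is "?f \<in> _")
proof -
  have "{k. ?f k \<noteq> 0} \<subseteq> {0, n}"
    by auto
  moreover from this have "finite {k. ?f k \<noteq> 0}"
    by (rule finite_subset) simp
  ultimately show ?thesis
    using assms act_eq_sum[of "{0, n}" ?f] by (auto simp: act_kernel_def crossed_product_def fixing_def)
qed

text \<open>
  A non-zero element with the fewest non-zero coefficients is shifted to have a coefficient at \<open>0\<close>.
  Since \<open>A\<close> is commutative, commutators with \<open>A\<close> lose that coefficient and so contradict minimality
  unless they vanish.
\<close>

lemma ideal_meets_coeff:
  assumes faithful: "\<forall>b :: 'a. (\<forall>a. b * a = 0) \<longrightarrow> b = 0"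
    and fixing: "\<forall>n. n \<noteq> 0 \<longrightarrow> fixing n = {0}"
    and I: "cp_ideal \<sigma> I" "I \<noteq> {\<lambda>_. 0}"
  shows "I \<inter> coeff_algebra \<noteq> {\<lambda>_. 0}"
proof -
  let ?size = "\<lambda>f :: int \<Rightarrow> 'a. card {k. f k \<noteq> 0}"
  have sub: "I \<subseteq> crossed_product" and zero: "(\<lambda>_. 0) \<in> I"
    and add: "\<And>f g. f \<in> I \<Longrightarrow> g \<in> I \<Longrightarrow> (\<lambda>n. f n + g n) \<in> I"
    and scale: "\<And>c f. f \<in> I \<Longrightarrow> (\<lambda>n. c *\<^sub>C f n) \<in> I"
    and conv: "\<And>f g. f \<in> I \<Longrightarrow> g \<in> crossed_product \<Longrightarrow> f \<star> g \<in> I"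
      "\<And>f g. f \<in> I \<Longrightarrow> g \<in> crossed_product \<Longrightarrow> g \<star> f \<in> I"
    using I(1) by (auto simp: cp_ideal_def cp_subspace_def)
  have "\<exists>f. f \<in> I \<and> f \<noteq> (\<lambda>_. 0)"
    using I(2) zero by blast
  then obtain f where f: "f \<in> I" "f \<noteq> (\<lambda>_. 0)"
    and least: "\<And>h. h \<in> I \<Longrightarrow> h \<noteq> (\<lambda>_. 0) \<Longrightarrow> ?size f \<le> ?size h"
    using ex_has_least_nat[of "\<lambda>f. f \<in> I \<and> f \<noteq> (\<lambda>_. 0)" _ ?size] by blast
  have fin: "finite {k. f k \<noteq> 0}"
    using f(1) sub by (auto simp: crossed_product_def)
  \<comment> \<open>Right multiplication by \<open>b \<delta>\<^sup>-\<^sup>n\<close> moves position \<open>n\<close> to \<open>0\<close>; the factor \<open>b\<close> replaces the possibly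
    missing unit and must not annihilate \<open>f\<^sub>n\<close>.\<close>
  obtain n where "f n \<noteq> 0"
    using f(2) by auto
  then obtain a where "f n * a \<noteq> 0"
    using faithful by blast
  then obtain b where b: "f n * pow n b \<noteq> 0"
    using pow_inverse(2)[of n a] by metis
  define g where "g = f \<star> monomial b (- n)"
  have g: "g m = f (m + n) * pow (m + n) b" for m
    using f(1) sub by (auto simp: g_def conv_monomial)
  have "g \<in> I"
    using f(1) by (simp add: g_def conv)
  have "g 0 \<noteq> 0"
    using b by (simp add: g)
  have supp_g: "{k. g k \<noteq> 0} \<subseteq> (\<lambda>k. k - n) ` {k. f k \<noteq> 0}"
  proof
    fix m
    assume "m \<in> {k. g k \<noteq> 0}"
    then have "m + n \<in> {k. f k \<noteq> 0}"
      by (auto simp: g)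
    then show "m \<in> (\<lambda>k. k - n) ` {k. f k \<noteq> 0}"
      by (rule rev_image_eqI) simp
  qed
  then have size_g: "?size g \<le> ?size f"
    using fin by (meson card_image_le card_mono finite_imageI order_trans)
  have fin_g: "finite {k. g k \<noteq> 0}"
    using supp_g fin by (meson finite_imageI finite_subset)
  have commutes: "g m * pow m a = a * g m" for m a
  proof -
    \<comment> \<open>the commutator \<open>a g - g a\<close>, written with the operations under which an ideal is closed\<close>
    define h where "h = (\<lambda>m. (monomial a 0 \<star> g) m + (-1) *\<^sub>C (g \<star> monomial a 0) m)"
    have h: "h m = a * g m - g m * pow m a" for m
      using \<open>g \<in> I\<close> sub by (auto simp: h_def monomial_conv conv_monomial uminus_eq_scaleC)
    have "h \<in> I"
      unfolding h_def using \<open>g \<in> I\<close> by (intro add scale conv) auto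
    have "{k. h k \<noteq> 0} \<subset> {k. g k \<noteq> 0}"
    proof
      show "{k. h k \<noteq> 0} \<subseteq> {k. g k \<noteq> 0}"
        by (auto simp: h)
      have "h 0 = 0"
        by (simp add: h mult.commute)
      with \<open>g 0 \<noteq> 0\<close> show "{k. h k \<noteq> 0} \<noteq> {k. g k \<noteq> 0}"
        by blast
    qed
    then have "?size h < ?size g"
      by (rule psubset_card_mono[OF fin_g])
    then have "h = (\<lambda>_. 0)"
      using least[OF \<open>h \<in> I\<close>] size_g by force
    then show ?thesis
      using h[of m] by (simp add: fun_eq_iff)
  qed
  have "g m = 0" if "m \<noteq> 0" for m
  proof -
    have "g m \<in> fixing m"
      using commutes by (simp add: fixing_def mult.commute)
    then show ?thesis
      using fixing that by simp
  qed
  then have "g \<in> I \<inter> coeff_algebra"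
    using \<open>g \<in> I\<close> by (simp add: coeff_algebra_iff)
  moreover have "g \<noteq> (\<lambda>_. 0)"
    using \<open>g 0 \<noteq> 0\<close> by auto
  ultimately show ?thesis
    by blast
qed

lemma ideals_meet_coeff_iff_fixing:
  assumes "\<forall>b :: 'a. (\<forall>a. b * a = 0) \<longrightarrow> b = 0"
  shows "(\<forall>I. cp_ideal \<sigma> I \<and> I \<noteq> {\<lambda>_. 0} \<longrightarrow> I \<inter> coeff_algebra \<noteq> {\<lambda>_. 0})
    \<longleftrightarrow> (\<forall>n. n \<noteq> 0 \<longrightarrow> fixing n = {0})"
proof
  assume "\<forall>I. cp_ideal \<sigma> I \<and> I \<noteq> {\<lambda>_. 0} \<longrightarrow> I \<inter> coeff_algebra \<noteq> {\<lambda>_. 0}"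
  then have kernel: "act_kernel = {\<lambda>_. 0}"
    using act_kernel_ideal act_kernel_inter_coeff[OF assms] by blast
  have "b = 0" if "n \<noteq> 0" "b \<in> fixing n" for n b
    using fun_cong[OF fixing_in_act_kernel[OF that(2,1), unfolded kernel singleton_iff], of 0]
    by simp
  then show "\<forall>n. n \<noteq> 0 \<longrightarrow> fixing n = {0}"
    using zero_fixing by blast
next
  assume fixing: "\<forall>n. n \<noteq> 0 \<longrightarrow> fixing n = {0}"
  show "\<forall>I. cp_ideal \<sigma> I \<and> I \<noteq> {\<lambda>_. 0} \<longrightarrow> I \<inter> coeff_algebra \<noteq> {\<lambda>_. 0}"
    by (intro allI impI ideal_meets_coeff[OF assms fixing]) simp_all
qed

section \<open>Density of the non-periodic characters\<close>

lemma periodic_points_eq: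
  "periodic_points \<sigma> n = {\<mu> \<in> character_space. \<forall>a. \<mu> (pow (- n) a) = \<mu> a}"
  unfolding periodic_points_def int_iter_dual_map[OF bij] fun_eq_iff comp_apply
  by (intro Collect_cong) metis

lemma closedin_periodic_points: "closedin gelfand_topology (periodic_points \<sigma> n)"
proof -
  have "closed (\<Inter>a. {\<mu> :: 'a \<Rightarrow> complex. \<mu> (pow (- n) a) = \<mu> a})"
    by (intro closed_INT ballI closed_Collect_eq continuous_on_eval)
  moreover have "periodic_points \<sigma> n
      = character_space \<inter> (\<Inter>a. {\<mu> :: 'a \<Rightarrow> complex. \<mu> (pow (- n) a) = \<mu> a})"
    by (auto simp: periodic_points_eq)
  ultimately show ?thesis
    by (auto simp: gelfand_topology_eq closedin_closed)
qed

text \<open>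
  The sign changes because the induced map on characters is composition with the inverse of \<open>\<sigma>\<close>.
\<close>

lemma fixing_iff_support_periodic:
  assumes "semisimple TYPE('a)"
  shows "b \<in> fixing n \<longleftrightarrow> {\<mu> \<in> character_space. \<mu> b \<noteq> 0} \<subseteq> periodic_points \<sigma> (- n)"
proof
  assume "b \<in> fixing n"
  then have eq: "b * pow n a = b * a" for a
    by (simp add: fixing_def)
  show "{\<mu> \<in> character_space. \<mu> b \<noteq> 0} \<subseteq> periodic_points \<sigma> (- n)"
  proof safe
    fix \<mu> :: "'a \<Rightarrow> complex"
    assume \<mu>: "\<mu> \<in> character_space" "\<mu> b \<noteq> 0"
    have "\<mu> b * \<mu> (pow n a) = \<mu> b * \<mu> a" for a
      using eq[of a] by (simp flip: character_simps(2)[OF \<mu>(1)])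
    with \<mu> show "\<mu> \<in> periodic_points \<sigma> (- n)"
      by (simp add: periodic_points_eq)
  qed
next
  assume *: "{\<mu> \<in> character_space. \<mu> b \<noteq> 0} \<subseteq> periodic_points \<sigma> (- n)"
  have "b * pow n a = b * a" for a
    using * by (intro semisimple_eqI[OF assms]) (auto simp: character_simps periodic_points_eq)
  then show "b \<in> fixing n"
    by (simp add: fixing_def)
qed

lemma openin_gelfand_support: "openin gelfand_topology {\<mu> \<in> character_space. \<mu> (b :: 'a) \<noteq> 0}"
proof -
  have "open {\<mu> :: 'a \<Rightarrow> complex. \<mu> b \<noteq> 0}"
    by (intro open_Collect_neq continuous_on_eval continuous_on_const)
  then show ?thesis
    by (auto simp: gelfand_topology_eq openin_open)
qed

text \<open>
  Regularity turns an interior point of the periodic set into an element whose Gelfand transform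
  lives inside that interior, and such an element belongs to \<open>fixing n\<close>. In the other direction the
  support of a non-zero element of \<open>fixing n\<close> is itself a non-empty open set of periodic points.
\<close>

lemma fixing_trivial_iff_interior_empty:
  assumes ss: "semisimple TYPE('a)" and reg: "regular TYPE('a)"
  shows "fixing n = {0} \<longleftrightarrow> gelfand_topology interior_of periodic_points \<sigma> (- n) = {}"
proof
  assume trivial: "fixing n = {0}"
  let ?U = "gelfand_topology interior_of periodic_points \<sigma> (- n)"
  show "?U = {}"
  proof (rule ccontr)
    assume "?U \<noteq> {}"
    then obtain \<mu> where \<mu>: "\<mu> \<in> ?U" by blast
    have U: "?U \<subseteq> character_space"
      using interior_of_subset_topspace[of gelfand_topology] by (simp add: topspace_gelfand_topology)
    have "closedin gelfand_topology (character_space - ?U)"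
      using closedin_diff[OF closedin_topspace openin_interior_of] topspace_gelfand_topology by metis
    moreover have "\<mu> \<in> character_space - (character_space - ?U)"
      using \<mu> U by auto
    ultimately obtain b where b: "\<forall>\<phi>\<in>character_space - ?U. gelfand_transform b \<phi> = 0"
      "gelfand_transform b \<mu> \<noteq> 0"
      using reg unfolding regular_def by blast
    have "{\<mu> \<in> character_space. \<mu> b \<noteq> 0} \<subseteq> ?U"
      using b(1) by (auto simp: gelfand_transform_def)
    also have "?U \<subseteq> periodic_points \<sigma> (- n)"
      by (rule interior_of_subset)
    finally have "b \<in> fixing n"
      unfolding fixing_iff_support_periodic[OF ss] .
    with trivial have "b = 0" by simp
    with b(2) \<mu> U show False
      by (auto simp: gelfand_transform_def character_simps)
  qed
next
  assume int: "gelfand_topology interior_of periodic_points \<sigma> (- n) = {}"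
  have "b = 0" if "b \<in> fixing n" for b
  proof (rule semisimple_eqI[OF ss])
    have "{\<mu> \<in> character_space. \<mu> b \<noteq> 0} \<subseteq> gelfand_topology interior_of periodic_points \<sigma> (- n)"
      using that openin_gelfand_support unfolding fixing_iff_support_periodic[OF ss]
      by (rule interior_of_maximal)
    then show "\<mu> b = \<mu> 0" if "\<mu> \<in> character_space" for \<mu>
      using int that by (auto simp: character_simps)
  qed
  then show "fixing n = {0}"
    using zero_fixing by blast
qed

text \<open>
  The non-periodic points are dense precisely when the union of the periodic sets has empty interior.
  This is a countable union of closed sets, so Baire's theorem for locally compact Hausdorff spaces
  reduces the question to the single periodic sets.
\<close>

lemma dense_iff_interiors_empty:
  "gelfand_topology closure_of nonperiodic_points \<sigma> = character_space
    \<longleftrightarrow> (\<forall>n. n \<noteq> 0 \<longrightarrow> gelfand_topology interior_of periodic_points \<sigma> n = {})"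
proof -
  let ?P = "periodic_points \<sigma> ` (UNIV - {0})"
  have "nonperiodic_points \<sigma> = topspace gelfand_topology - \<Union>?P"
  proof -
    have "\<not> UNIV \<subseteq> {0 :: int}"
      by (metis UNIV_I one_neq_zero singletonD subsetD)
    then show ?thesis
      by (simp add: nonperiodic_points_def topspace_gelfand_topology)
  qed
  then have "gelfand_topology closure_of nonperiodic_points \<sigma>
      = topspace gelfand_topology - gelfand_topology interior_of \<Union>?P"
    by (simp only: closure_of_complement)
  moreover have "gelfand_topology interior_of \<Union>?P \<subseteq> character_space"
    unfolding topspace_gelfand_topology[symmetric] by (rule interior_of_subset_topspace)
  ultimately have "gelfand_topology closure_of nonperiodic_points \<sigma> = character_space
      \<longleftrightarrow> gelfand_topology interior_of \<Union>?P = {}"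
  proof -
    have "A - X = A \<longleftrightarrow> X = {}" if "X \<subseteq> A" for A X :: "'b set"
      using that by blast
    then show ?thesis
      using \<open>gelfand_topology interior_of \<Union>?P \<subseteq> character_space\<close>
      unfolding \<open>gelfand_topology closure_of nonperiodic_points \<sigma> = _\<close> topspace_gelfand_topology
      by this
  qed
  also have "\<dots> \<longleftrightarrow> (\<forall>n. n \<noteq> 0 \<longrightarrow> gelfand_topology interior_of periodic_points \<sigma> n = {})"
  proof (intro iffI allI impI)
    fix n :: int
    assume "gelfand_topology interior_of \<Union>?P = {}" "n \<noteq> 0"
    moreover have "gelfand_topology interior_of periodic_points \<sigma> n
        \<subseteq> gelfand_topology interior_of \<Union>?P"
      using \<open>n \<noteq> 0\<close> by (intro interior_of_mono) auto
    ultimately show "gelfand_topology interior_of periodic_points \<sigma> n = {}"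
      by blast
  next
    assume int: "\<forall>n. n \<noteq> 0 \<longrightarrow> gelfand_topology interior_of periodic_points \<sigma> n = {}"
    show "gelfand_topology interior_of \<Union>?P = {}"
    proof (rule Baire_category_alt)
      show "completely_metrizable_space gelfand_topology
          \<or> locally_compact_space gelfand_topology
            \<and> regular_space (gelfand_topology :: ('a \<Rightarrow> complex) topology)"
        by (intro disjI2 conjI locally_compact_gelfand
            locally_compact_Hausdorff_imp_regular_space Hausdorff_gelfand)
      show "countable ?P"
        by simp
      show "closedin gelfand_topology T \<and> gelfand_topology interior_of T = {}" if "T \<in> ?P" for T
      proof -
        from that obtain n where "n \<noteq> 0" "T = periodic_points \<sigma> n"
          by (elim imageE) simp
        then show ?thesis
          using int closedin_periodic_points by simp
      qed
    qed
  qed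
  finally show ?thesis .
qed

end

theorem corollary4p5:
  fixes \<sigma> :: "'a::comm_complex_banach_algebra \<Rightarrow> 'a"
  assumes "semisimple TYPE('a)"
    and "regular TYPE('a)"
    and "algebra_automorphism \<sigma>"
  shows "(gelfand_topology closure_of nonperiodic_points \<sigma> = character_space
            \<longleftrightarrow> (\<forall>I. cp_ideal \<sigma> I \<and> I \<noteq> {\<lambda>_. 0} \<longrightarrow> I \<inter> coeff_algebra \<noteq> {\<lambda>_. 0}))
       \<and> ((\<forall>I. cp_ideal \<sigma> I \<and> I \<noteq> {\<lambda>_. 0} \<longrightarrow> I \<inter> coeff_algebra \<noteq> {\<lambda>_. 0})
            \<longleftrightarrow> cp_maximal_abelian_subalgebra \<sigma> coeff_algebra)"
proof -
  interpret crossed_product_algebra \<sigma>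
    by standard (rule assms(3))
  have faithful: "\<forall>b :: 'a. (\<forall>a. b * a = 0) \<longrightarrow> b = 0"
    using semisimple_annihilator[OF assms(1)] by simp
  (* fixing n corresponds to period -n, while density is expressed through all non-zero periods n. *)
  have sign: "(\<forall>n. n \<noteq> 0 \<longrightarrow> P n) \<longleftrightarrow> (\<forall>n. n \<noteq> 0 \<longrightarrow> P (- n))" for P :: "int \<Rightarrow> bool"
    by (metis minus_minus neg_equal_0_iff_equal)
  have "gelfand_topology closure_of nonperiodic_points \<sigma> = character_space
      \<longleftrightarrow> (\<forall>n. n \<noteq> 0 \<longrightarrow> fixing n = {0})"
    unfolding dense_iff_interiors_empty fixing_trivial_iff_interior_empty[OF assms(1,2)]
    by (rule sign)
  then show ?thesis
    unfolding maximal_abelian_iff_fixing ideals_meet_coeff_iff_fixing[OF faithful]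
    by (rule conjI) (rule refl)
qed

end
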